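(* Let $k\ge2$ be an integer, $L>0$, let $\mathcal{D}$ be a good probability distribution on $[0,1]^{k-1}$, and let $0\le r<1/k$. Consider the continuous fragmentation process with $k$ parts started from $R$ living sticks of length $L$, in which each newly created stick is alive with probability $r$ and dead with probability $1-r$, where the alive/dead statuses of the $k$ children of the same stick are possibly dependent on one another. Then for all sufficiently large bases $B$, the collection of ending stick lengths does not converge to strong Benford behavior base $B$ as $R\to\infty$.
   Context: Significand: for $B>1$, each $x>0$ is written uniquely as $x=S_B(x)B^{j}$ with $S_B(x)\in[1,B)$, $j\in\mathbb{Z}$; $S_B(x)$ is the significand. Let $P_R(s)$ be the proportion of ending sticks (counted with multiplicity) whose length has significand at most $s$. The collection of ending stick lengths converges to strong Benford behavior base $B$ as $R\to\infty$ if for every $s\in[1,B)$ one has $\mathbb{E}[P_R(s)]\to\log_B s$ and $\operatorname{Var}[P_R(s)]\to0$. Good distributions: let $\mathcal{D}$ be a probability distribution on $\mathbb{R}^d$ supported on $[0,1]^d$. For $X\sim\mathcal{D}$ let $\mathrm{rk}_i(X)$ be its $i$-th smallest coordinate ($1\le i\le d$), $\mathrm{rk}_0(X)=0$, $\mathrm{rk}_{d+1}(X)=1$. $\mathcal{D}$ is good if for all $0\le i\le d$ the random variable $\mathrm{rk}_{i+1}(X)-\mathrm{rk}_i(X)$ has a Hölder continuous density (a density being a function on $[0,\infty)$). Process: all $R$ initial sticks are alive. At each level every living stick, of length $\ell$ say, is broken into $k$ pieces (its children) of lengths $\ell(\mathrm{rk}_{i+1}(X)-\mathrm{rk}_i(X))$,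 $0\le i\le k-1$, where $X\sim\mathcal{D}$ is sampled independently for each living stick. Each child is then declared alive (it will be broken at the next level) or dead (it is never broken again). For each broken stick the vector of statuses of its $k$ children may have an arbitrary joint law with each child alive with probability $r$; the status vectors belonging to different broken sticks are independent of each other, and statuses are independent of the cut points. The process ends when there are no living sticks (for $r<1/k$ this happens in finitely many levels with probability $1$); the ending sticks are all the dead sticks. *)

theory Defs
  imports "HOL-Probability.Probability"
begin

definition significand :: "real \<Rightarrow> real \<Rightarrow> real" where
  "significand B x = (THE m. 1 \<le> m \<and> m < B \<and> (\<exists>j::int. x = m * B powi j))"

text \<open>A collection with multiplicities is an index set \<open>E\<close> together with lengths
  \<open>l v\<close> for \<open>v \<in> E\<close>. If \<open>E\<close> is infinite (for ending sticks an event of probability zero when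
  \<open>r < 1 / k\<close>) the value is \<open>0\<close>.\<close>

definition proportion_le :: "real \<Rightarrow> 'v set \<Rightarrow> ('v \<Rightarrow> real) \<Rightarrow> real \<Rightarrow> real" where
  "proportion_le B E l s = real (card {v \<in> E. significand B (l v) \<le> s}) / real (card E)"

text \<open>Expectations and variances for different \<open>R\<close> are unrelated, so each \<open>R\<close> may come
  with its own probability space \<open>M R\<close>.\<close>

definition strong_benford ::
  "real \<Rightarrow> (nat \<Rightarrow> 'a measure) \<Rightarrow> (nat \<Rightarrow> 'a \<Rightarrow> 'v set) \<Rightarrow> (nat \<Rightarrow> 'a \<Rightarrow> 'v \<Rightarrow> real) \<Rightarrow> bool" where
  "strong_benford B M E l \<longleftrightarrow> (\<forall>s\<in>{1..<B}.
     (\<lambda>R. prob_space.expectation (M R) (\<lambda>\<omega>. proportion_le B (E R \<omega>) (l R \<omega>) s)) \<longlonglongrightarrow> log B s \<and>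
     (\<lambda>R. prob_space.variance (M R) (\<lambda>\<omega>. proportion_le B (E R \<omega>) (l R \<omega>) s)) \<longlonglongrightarrow> 0)"

text \<open>Points of \<open>\<real>\<^sup>d\<close> are elements of the product space below; coordinates are numbered from 0.\<close>

abbreviation cut_space :: "nat \<Rightarrow> (nat \<Rightarrow> real) measure" where
  "cut_space d \<equiv> PiM {..<d} (\<lambda>_. borel)"

definition rk :: "nat \<Rightarrow> (nat \<Rightarrow> real) \<Rightarrow> nat \<Rightarrow> real" where
  "rk d x i = (if i = 0 then 0 else if i \<le> d then sort (map x [0..<d]) ! (i - 1) else 1)"

definition gap :: "nat \<Rightarrow> (nat \<Rightarrow> real) \<Rightarrow> nat \<Rightarrow> real" where
  "gap d x i = rk d x (Suc i) - rk d x i"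

definition holder_continuous_on :: "real set \<Rightarrow> (real \<Rightarrow> real) \<Rightarrow> bool" where
  "holder_continuous_on S f \<longleftrightarrow>
     (\<exists>\<alpha> C. 0 < \<alpha> \<and> \<alpha> \<le> 1 \<and> (\<forall>x\<in>S. \<forall>y\<in>S. \<bar>f x - f y\<bar> \<le> C * \<bar>x - y\<bar> powr \<alpha>))"

text \<open>The density \<open>f\<close> is a function on \<open>[0, \<infinity>)\<close>; only its values there matter. In particular
  it must vanish continuously at \<open>1\<close>, but may have \<open>f 0 > 0\<close>.\<close>

definition good_distribution :: "nat \<Rightarrow> (nat \<Rightarrow> real) measure \<Rightarrow> bool" where
  "good_distribution d D \<longleftrightarrow>
     prob_space D \<and> sets D = sets (cut_space d) \<and>
     (AE x in D. \<forall>i<d. x i \<in> {0..1}) \<and>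
     (\<forall>i\<le>d. \<exists>f. (\<forall>t\<ge>0. 0 \<le> f t) \<and> holder_continuous_on {0..} f \<and>
        distributed D lborel (\<lambda>x. gap d x i) (\<lambda>t. ennreal (if 0 \<le> t then f t else 0)))"

text \<open>A stick is named by \<open>(j, p)\<close>: \<open>j\<close> is the initial stick it descends from, and \<open>p\<close> lists the
  child indices on the way from that stick, the most recent one first; thus \<open>(j, i # p)\<close> is the
  \<open>i\<close>-th child of \<open>(j, p)\<close>.\<close>

type_synonym stick = "nat \<times> nat list"

definition sticks :: "nat \<Rightarrow> nat \<Rightarrow> stick set" where
  "sticks k R = {..<R} \<times> lists {..<k}"

text \<open>Below, \<open>x v\<close> are the cut points used if stick \<open>v\<close> is broken, and \<open>a v\<close> is the set of those
  children of \<open>v\<close> that are then declared alive; this set encodes the status vector.\<close>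

fun stick_length :: "nat \<Rightarrow> real \<Rightarrow> (stick \<Rightarrow> nat \<Rightarrow> real) \<Rightarrow> stick \<Rightarrow> real" where
  "stick_length k L x (j, []) = L"
| "stick_length k L x (j, i # p) = stick_length k L x (j, p) * gap (k - 1) (x (j, p)) i"

inductive_set living :: "nat \<Rightarrow> nat \<Rightarrow> (stick \<Rightarrow> nat set) \<Rightarrow> stick set" for k R a where
  initial: "j < R \<Longrightarrow> (j, []) \<in> living k R a"
| child: "(j, p) \<in> living k R a \<Longrightarrow> i < k \<Longrightarrow> i \<in> a (j, p) \<Longrightarrow> (j, i # p) \<in> living k R a"

definition ending :: "nat \<Rightarrow> nat \<Rightarrow> (stick \<Rightarrow> nat set) \<Rightarrow> stick set" where
  "ending k R a = {(j, i # p) |j i p. (j, p) \<in> living k R a \<and> i < k \<and> i \<notin> a (j, p)}"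

text \<open>Cut points and status vectors are attached to every potential stick, but only those of
  living sticks are ever used. The last clause is the mutual independence of all cut point vectors
  and all status vectors; \<open>indep_vars\<close> is not applicable as their types differ. The joint
  law of the statuses of the children of one stick is constrained only in its marginals, and may
  vary from stick to stick.\<close>

definition fragmentation_process ::
  "nat \<Rightarrow> (nat \<Rightarrow> real) measure \<Rightarrow> real \<Rightarrow> nat \<Rightarrow> 'a measure \<Rightarrow>
   (stick \<Rightarrow> 'a \<Rightarrow> nat \<Rightarrow> real) \<Rightarrow> (stick \<Rightarrow> 'a \<Rightarrow> nat set) \<Rightarrow> bool" where
  "fragmentation_process k D r R M X A \<longleftrightarrow>
     prob_space M \<and>
     (\<forall>v\<in>sticks k R.
        X v \<in> measurable M (cut_space (k - 1)) \<and> distr M (cut_space (k - 1)) (X v) = D \<and>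
        A v \<in> measurable M (count_space (Pow {..<k})) \<and>
        (\<forall>i<k. measure M {\<omega> \<in> space M. i \<in> A v \<omega>} = r)) \<and>
     prob_space.indep_sets M
       (case_sum (\<lambda>v. sets (vimage_algebra (space M) (X v) (cut_space (k - 1))))
                 (\<lambda>v. sets (vimage_algebra (space M) (A v) (count_space (Pow {..<k})))))
       (sticks k R <+> sticks k R)"

end

theory Submission
  imports Defs
begin

text \<open>On the scale of \<open>log B\<close>, a large base \<open>B\<close> sees every fixed range of lengths \<open>[L / k, L]\<close> as almost a
  single point: the significands of such lengths lie in a set of logarithmic measure \<open>O(1 / ln B)\<close>.
  Benford behavior would leave only that vanishing proportion to these lengths. The process,
  however, puts an expected proportion of ending sticks there that is bounded below independently
  of \<open>B\<close> and \<open>R\<close>, and this is a contradiction for large \<open>B\<close>.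

  For the lower bound it suffices to look at the children of the initial sticks. The \<open>k\<close> pieces of a
  stick have total length \<open>L\<close>, so one of them has length at least \<open>L / k\<close>; each child is dead with
  probability \<open>1 - r\<close>, independently of the cut. Hence the number \<open>G\<close> of dead children with length
  in \<open>[L / k, L]\<close> has expectation at least \<open>R * (1 - r)\<close> (\<open>large_dead_count\<close>). On the other hand, a
  stick of level \<open>m\<close> is alive with probability \<open>r ^ m\<close>, by independence along its line of ancestors,
  so the expected number of living sticks is a geometric series with sum \<open>R / (1 - k * r)\<close>
  (\<open>living_count\<close>), and there are at most \<open>k\<close> times as many ending sticks.

  The quotient of the two random numbers is handled by replacing \<open>1 / N\<close> by its tangent line: for
  all \<open>N, C > 0\<close> one has \<open>1 / N \<ge> 2 / C - N / C\<^sup>2\<close>. With \<open>C\<close> a suitable multiple of \<open>R\<close>, and with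
  \<open>G \<le> k * R\<close>, the two expectations alone bound \<open>E[G / N]\<close> from below by the constant
  \<open>c = (1 - r)\<^sup>2 * (1 - k * r) / k\<^sup>2\<close> (\<open>expectation_proportion_between\<close>). So the expected
  proportion of significands in \<open>(s, s']\<close>, where \<open>s = L + 1\<close> and \<open>s' = \<delta> * B\<close>, is at most \<open>1 - c\<close> for
  every \<open>R\<close>, whereas \<open>log B s' - log B s\<close> tends to 1 as \<open>B\<close> grows.\<close>

section \<open>Significands\<close>

lemma significand_eq:
  assumes "1 \<le> m" "m < B"
  shows "significand B (m * B powi j) = m"
  unfolding significand_def
proof (rule the_equality)
  show "1 \<le> m \<and> m < B \<and> (\<exists>i::int. m * B powi j = m * B powi i)"
    using assms by blast
next
  fix m' assume "1 \<le> m' \<and> m' < B \<and> (\<exists>i::int. m * B powi j = m' * B powi i)"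
  then obtain i :: int where m': "1 \<le> m'" "m' < B" and eq: "m * B powi j = m' * B powi i"
    by blast
  have B: "1 < B" using assms by simp
  have no_shift: False
    if a: "1 \<le> a" and b: "b < B" and e: "a * B powi p = b * B powi q" and less: "q < p"
    for a b and p q :: int
  proof -
    have "B powi p = B powi (p - q) * B powi q"
      using B power_int_add[of B "p - q" q] by simp
    with e B have "a * B powi (p - q) = b" by simp
    moreover have "B powi 1 \<le> B powi (p - q)"
      using B less by (intro power_int_increasing) auto
    then have "1 * B \<le> a * B powi (p - q)"
      using a B by (intro mult_mono) auto
    ultimately show False using b by simp
  qed
  have "i = j"
    using no_shift[OF assms(1) m'(2) eq] no_shift[OF m'(1) assms(2) eq[symmetric]] by force
  with eq B show "m' = m" by simp
qed

text \<open>Lengths in a fixed range have significands near one of the two ends of \<open>[1, B)\<close>: a length above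
  1 is its own significand, and a length below 1 is shifted by exactly one power of the base.\<close>

lemma significand_of_bounded_length:
  assumes "0 < a" "a \<le> x" "x \<le> b" "b < B" "1 \<le> B * a" "1 < B"
  shows "significand B x \<le> b \<or> B * a \<le> significand B x"
proof (cases "1 \<le> x")
  case True
  then show ?thesis using significand_eq[of x B 0] assms by simp
next
  case False
  have ax: "B * a \<le> B * x" using assms by simp
  have "1 \<le> B * x" using ax assms(5) by linarith
  then have "significand B (B * x * B powi (-1)) = B * x"
    using False assms by (intro significand_eq) auto
  moreover have "B * x * B powi (-1) = x" using assms(6) by (simp add: power_int_minus)
  ultimately show ?thesis using ax by metis
qed

section \<open>A large piece of a broken stick\<close>

lemma sum_gap: "(\<Sum>i<Suc d. gap d x i) = 1"
  unfolding gap_def by (subst sum_lessThan_telescope) (simp add: rk_def)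

lemma gap_nonneg:
  assumes "\<And>i. i < d \<Longrightarrow> x i \<in> {0..1}" "i \<le> d"
  shows "0 \<le> gap d x i"
proof -
  define xs where "xs = sort (map x [0..<d])"
  have len: "length xs = d" by (simp add: xs_def)
  have set: "set xs \<subseteq> {0..1}" using assms(1) by (auto simp: xs_def)
  have nth: "xs ! n \<in> {0..1}" if "n < d" for n using set len that nth_mem by blast
  have mono: "xs ! m \<le> xs ! n" if "m \<le> n" "n < d" for m n
    using sorted_nth_mono[of xs m n] that len by (simp add: xs_def)
  have rk: "rk d x i = (if i = 0 then 0 else if i \<le> d then xs ! (i - 1) else 1)" for i
    by (simp add: rk_def xs_def)
  show ?thesis
    using nth[of 0] nth[of "i - 1"] mono[of "i - 1" i] assms(2)
    unfolding gap_def rk by (cases "i = 0"; cases "i = d") auto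
qed

text \<open>The gaps add up to 1, so their maximum is at least their mean.\<close>

lemma ex_large_gap:
  assumes "\<And>i. i < d \<Longrightarrow> x i \<in> {0..1}"
  shows "\<exists>i<Suc d. 1 / real (Suc d) \<le> gap d x i \<and> gap d x i \<le> 1"
proof -
  have "\<exists>i<Suc d. 1 / real (Suc d) \<le> gap d x i"
  proof (rule ccontr)
    assume "\<not> ?thesis"
    then have "(\<Sum>i<Suc d. gap d x i) < (\<Sum>i<Suc d. 1 / real (Suc d))"
      by (intro sum_strict_mono) auto
    then show False unfolding sum_gap by (simp add: field_simps)
  qed
  then obtain i where i: "i < Suc d" "1 / real (Suc d) \<le> gap d x i" by blast
  have "gap d x i \<le> (\<Sum>i<Suc d. gap d x i)"
    using i assms by (intro member_le_sum gap_nonneg) auto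
  with i show ?thesis unfolding sum_gap by blast
qed

lemma sum_prob_large_gap:
  assumes "good_distribution d D"
  shows "1 \<le> (\<Sum>i<Suc d. measure D {x \<in> space D. gap d x i \<in> {1 / real (Suc d)..1}})"
    and "i \<le> d \<Longrightarrow> {x \<in> space D. gap d x i \<in> {1 / real (Suc d)..1}} \<in> sets D"
proof -
  interpret prob_space D using assms by (simp add: good_distribution_def)
  have meas: "{x \<in> space D. gap d x i \<in> {1 / real (Suc d)..1}} \<in> sets D" if i: "i \<le> d" for i
  proof -
    have "(\<lambda>x. gap d x i) \<in> measurable D lborel"
      using assms i unfolding good_distribution_def by (blast intro: distributed_measurable)
    then have [measurable]: "(\<lambda>x. gap d x i) \<in> borel_measurable D" by simp
    show ?thesis by measurable
  qed
  then show "i \<le> d \<Longrightarrow> {x \<in> space D. gap d x i \<in> {1 / real (Suc d)..1}} \<in> sets D" .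
  have "AE x in D. \<forall>i<d. x i \<in> {0..1}"
    using assms by (simp add: good_distribution_def)
  then have "AE x in D. x \<in> (\<Union>i<Suc d. {x \<in> space D. gap d x i \<in> {1 / real (Suc d)..1}})"
    using AE_space
  proof eventually_elim
    case (elim x)
    then show ?case using ex_large_gap[of d x] by auto
  qed
  then have "1 = prob (\<Union>i<Suc d. {x \<in> space D. gap d x i \<in> {1 / real (Suc d)..1}})"
    using meas by (subst prob_eq_1[THEN iffD2]) (auto intro!: sets.finite_UN)
  also have "\<dots> \<le> (\<Sum>i<Suc d. prob {x \<in> space D. gap d x i \<in> {1 / real (Suc d)..1}})"
    using meas by (intro finite_measure_subadditive_finite) auto
  finally show "1 \<le> (\<Sum>i<Suc d. prob {x \<in> space D. gap d x i \<in> {1 / real (Suc d)..1}})" .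
qed

section \<open>Living and ending sticks\<close>

text \<open>The ancestors of \<open>(j, p)\<close> are named by the proper suffixes of \<open>p\<close>. Writing life as a conjunction of
  one condition on the status vector of each ancestor makes it accessible to independence.\<close>

lemma living_iff:
  "(j, p) \<in> living k R a \<longleftrightarrow>
     j < R \<and> (\<forall>n<length p. p ! n < k \<and> p ! n \<in> a (j, drop (Suc n) p))"
proof (induction p)
  case Nil
  show ?case by (auto intro: living.initial elim: living.cases)
next
  case (Cons i p)
  have "(j, i # p) \<in> living k R a \<longleftrightarrow> (j, p) \<in> living k R a \<and> i < k \<and> i \<in> a (j, p)"
    by (auto intro: living.child elim: living.cases)
  then show ?case unfolding Cons.IH by (auto simp: less_Suc_eq_0_disj)
qed

lemma living_subset_sticks: "living k R a \<subseteq> sticks k R"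
  by (auto simp: living_iff sticks_def in_lists_conv_set in_set_conv_nth)

lemma ending_subset: "ending k R a \<subseteq> (\<lambda>((j, p), i). (j, i # p)) ` (living k R a \<times> {..<k})"
  by (force simp: ending_def)

lemma finite_ending: "finite (living k R a) \<Longrightarrow> finite (ending k R a)"
  by (rule finite_subset[OF ending_subset]) auto

lemma card_ending_le:
  assumes "finite (living k R a)"
  shows "card (ending k R a) \<le> k * card (living k R a)"
proof -
  have "card (ending k R a) \<le> card ((\<lambda>((j, p), i). (j, i # p)) ` (living k R a \<times> {..<k}))"
    using assms by (intro card_mono ending_subset) auto
  also have "\<dots> \<le> card (living k R a \<times> {..<k})"
    using assms by (intro card_image_le) auto
  finally show ?thesis by (simp add: card_cartesian_product mult.commute)
qed

text \<open>The pair \<open>(j, i)\<close> stands for the stick \<open>(j, [i])\<close>. The upper bound on the gap holds only almost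
  surely; as a part of the definition it makes the bound \<open>L\<close> on the length hold at every point of
  the probability space.\<close>

definition dead_large_child :: "nat \<Rightarrow> (stick \<Rightarrow> nat \<Rightarrow> real) \<Rightarrow> (stick \<Rightarrow> nat set) \<Rightarrow> nat \<times> nat \<Rightarrow> bool" where
  "dead_large_child k x a = (\<lambda>(j, i). gap (k - 1) (x (j, [])) i \<in> {1 / real k..1} \<and> i \<notin> a (j, []))"

text \<open>Dead large children have no significand in \<open>(s, s']\<close>, so the proportion in question is at most
  \<open>1 - G / N\<close>, where \<open>N\<close> is the number of ending sticks. The quotient is then bounded by the tangent
  line of \<open>1 / N\<close> at \<open>C\<close>, and \<open>N\<close> by \<open>k\<close> times the number of living sticks, so that only
  quantities with accessible expectations remain.\<close>

lemma proportion_between: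
  fixes k :: nat and x :: "stick \<Rightarrow> nat \<Rightarrow> real"
  assumes L: "L > 0" and k: "k > 0" and B: "L < B" "1 < B" "1 \<le> B * (L / k)" and C: "C > 0"
    and s: "L \<le> s" "s' < B * (L / k)"
    and fin: "finite (living k R a)"
  defines "E \<equiv> ending k R a"
  defines "P \<equiv> proportion_le B E (stick_length k L x)"
  defines "G \<equiv> card {w \<in> {..<R} \<times> {..<k}. dead_large_child k x a w}"
  shows "P s' - P s \<le> 1 - real G * (2 / C - real k * card (living k R a) / C\<^sup>2)"
proof -
  define W where "W = (\<lambda>(j, i). (j, [i])) ` {w \<in> {..<R} \<times> {..<k}. dead_large_child k x a w}"
  have finE: "finite E" unfolding E_def by (rule finite_ending[OF fin])
  have WE: "W \<subseteq> E"
    by (auto simp: W_def E_def ending_def dead_large_child_def intro: living.initial)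
  have finW: "finite W" using WE finE finite_subset by blast
  have cardW: "card W = G"
    unfolding W_def G_def by (intro card_image inj_onI) auto
  have sig: "significand B (stick_length k L x v) \<le> s \<or> s' < significand B (stick_length k L x v)"
    if "v \<in> W" for v
  proof -
    obtain j i where v: "v = (j, [i])" and g: "gap (k - 1) (x (j, [])) i \<in> {1 / real k..1}"
      using \<open>v \<in> W\<close> by (auto simp: W_def dead_large_child_def)
    have len: "L / k \<le> stick_length k L x v" "stick_length k L x v \<le> L"
      using g L mult_left_mono[of "1 / real k" "gap (k - 1) (x (j, [])) i" L] by (auto simp: v)
    show ?thesis
      using significand_of_bounded_length[OF _ len B(1,3,2)] L k s by fastforce
  qed
  have "{v \<in> E. significand B (stick_length k L x v) \<le> s'}
      \<subseteq> {v \<in> E. significand B (stick_length k L x v) \<le> s} \<union> (E - W)"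
    using sig by fastforce
  then have "card {v \<in> E. significand B (stick_length k L x v) \<le> s'}
      \<le> card ({v \<in> E. significand B (stick_length k L x v) \<le> s} \<union> (E - W))"
    using finE by (intro card_mono) auto
  also have "\<dots> \<le> card {v \<in> E. significand B (stick_length k L x v) \<le> s} + card (E - W)"
    by (rule card_Un_le)
  finally have num: "real (card {v \<in> E. significand B (stick_length k L x v) \<le> s'})
      \<le> card {v \<in> E. significand B (stick_length k L x v) \<le> s} + (real (card E) - real G)"
    using card_Diff_subset[OF finW WE] card_mono[OF finE WE] cardW by linarith
  show ?thesis
  proof (cases "card E = 0")
    case True
    then have "G = 0" using WE finE cardW by auto
    with True show ?thesis by (simp add: P_def proportion_le_def)
  next
    case False
    define N where "N = real (card E)"
    have N: "N > 0" using False by (simp add: N_def)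
    have "P s' - P s \<le> 1 - G / N"
      using divide_right_mono[OF num, of N] N unfolding P_def proportion_le_def N_def[symmetric]
      by (simp add: add_divide_distrib diff_divide_distrib)
    \<comment> \<open>the convex function \<open>1 / N\<close> lies above its tangent line at \<open>C\<close>\<close>
    moreover have "G * (2 / C - N / C\<^sup>2) \<le> G / N"
    proof -
      have "1 / N - (2 / C - N / C\<^sup>2) = N * (1 / N - 1 / C)\<^sup>2"
        using N C by (simp add: field_simps power2_eq_square)
      also have "\<dots> \<ge> 0" using N by simp
      finally have "G * (2 / C - N / C\<^sup>2) \<le> G * (1 / N)" by (intro mult_left_mono) auto
      then show ?thesis by simp
    qed
    moreover have "N \<le> real k * card (living k R a)"
      using card_ending_le[OF fin] unfolding N_def E_def by (simp flip: of_nat_mult)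
    then have "G * (2 / C - real k * card (living k R a) / C\<^sup>2) \<le> G * (2 / C - N / C\<^sup>2)"
      by (intro mult_left_mono diff_left_mono divide_right_mono) auto
    ultimately show ?thesis by linarith
  qed
qed

section \<open>Expectations in the fragmentation process\<close>

locale fragmentation = prob_space M for M :: "'a measure" +
  fixes k :: nat and D :: "(nat \<Rightarrow> real) measure" and r :: real and R :: nat
    and X :: "stick \<Rightarrow> 'a \<Rightarrow> nat \<Rightarrow> real" and A :: "stick \<Rightarrow> 'a \<Rightarrow> nat set"
  assumes process: "fragmentation_process k D r R M X A"
    and k: "k > 0" and r0: "0 \<le> r" and r1: "r < 1 / real k"
    and good: "good_distribution (k - 1) D"
begin

abbreviation cut_algebra :: "stick \<Rightarrow> 'a set set" where
  "cut_algebra v \<equiv> sets (vimage_algebra (space M) (X v) (cut_space (k - 1)))"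

abbreviation status_algebra :: "stick \<Rightarrow> 'a set set" where
  "status_algebra v \<equiv> sets (vimage_algebra (space M) (A v) (count_space (Pow {..<k})))"

lemma indep: "indep_sets (case_sum cut_algebra status_algebra) (sticks k R <+> sticks k R)"
  using process by (simp add: fragmentation_process_def)

lemma algebra_events:
  assumes "v \<in> sticks k R"
  shows "cut_algebra v \<subseteq> events" "status_algebra v \<subseteq> events"
proof -
  have "\<forall>u\<in>sticks k R <+> sticks k R. case_sum cut_algebra status_algebra u \<subseteq> events"
    using indep unfolding indep_sets_def by (rule conjunct1)
  from bspec[OF this, of "Inl v"] bspec[OF this, of "Inr v"]
  show "cut_algebra v \<subseteq> events" "status_algebra v \<subseteq> events"
    using assms by (simp_all add: InlI InrI)
qed

lemma status_event:
  assumes "v \<in> sticks k R"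
  shows "{\<omega> \<in> space M. Q (A v \<omega>)} \<in> status_algebra v"
proof -
  have A: "A v \<in> measurable M (count_space (Pow {..<k}))"
    using process assms by (simp add: fragmentation_process_def)
  have "A v \<omega> \<in> Pow {..<k}" if "\<omega> \<in> space M" for \<omega>
    using measurable_space[OF A that] by (simp only: space_count_space)
  then have "{\<omega> \<in> space M. Q (A v \<omega>)} = A v -` {S \<in> Pow {..<k}. Q S} \<inter> space M"
    by blast
  then show ?thesis by (simp only:) (rule in_vimage_algebra, auto)
qed

lemma prob_alive: "v \<in> sticks k R \<Longrightarrow> i < k \<Longrightarrow> prob {\<omega> \<in> space M. i \<in> A v \<omega>} = r"
  using process by (simp add: fragmentation_process_def)

text \<open>Distinct ancestors have distinct status vectors, which are independent, and each of the
  \<open>length (snd v)\<close> conditions on them has probability \<open>r\<close>.\<close>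

lemma living_event:
  assumes "v \<in> sticks k R"
  shows "{\<omega> \<in> space M. v \<in> living k R (\<lambda>v. A v \<omega>)} \<in> events"
    and "prob {\<omega> \<in> space M. v \<in> living k R (\<lambda>v. A v \<omega>)} = r ^ length (snd v)"
proof -
  obtain j p where v: "v = (j, p)" by force
  have j: "j < R" and p: "set p \<subseteq> {..<k}" using assms by (auto simp: v sticks_def)
  define w where "w n = (j, drop (Suc n) p)" for n
  define f where "f n = {\<omega> \<in> space M. p ! n \<in> A (w n) \<omega>}" for n
  have pn: "p ! n < k" if "n < length p" for n using p nth_mem[OF that] by auto
  have w: "w n \<in> sticks k R" for n
    using j p set_drop_subset[of "Suc n" p] by (auto simp: w_def sticks_def in_lists_conv_set)
  have f: "f n \<in> status_algebra (w n)" for n unfolding f_def by (rule status_event[OF w])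
  have fe: "f n \<in> events" for n using f algebra_events(2)[OF w] by blast
  have eq: "{\<omega> \<in> space M. v \<in> living k R (\<lambda>v. A v \<omega>)} = space M \<inter> (\<Inter>n<length p. f n)"
    using j pn by (auto simp: v living_iff f_def w_def)
  show "{\<omega> \<in> space M. v \<in> living k R (\<lambda>v. A v \<omega>)} \<in> events"
    unfolding eq using fe by (cases "p = []") (auto intro!: sets.Int sets.finite_INT)
  show "prob {\<omega> \<in> space M. v \<in> living k R (\<lambda>v. A v \<omega>)} = r ^ length (snd v)"
  proof (cases "p = []")
    case True
    then show ?thesis unfolding eq by (simp add: v prob_space)
  next
    case False
    have inj: "inj_on (\<lambda>n. Inr (w n) :: stick + stick) {..<length p}"
    proof (rule inj_onI)
      fix m n assume mn: "m \<in> {..<length p}" "n \<in> {..<length p}"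
        and "(Inr (w m) :: stick + stick) = Inr (w n)"
      then have "length (drop (Suc m) p) = length (drop (Suc n) p)" by (simp add: w_def)
      with mn show "m = n" by auto
    qed
    \<comment> \<open>independence is indexed by names of vectors, not by levels: \<open>?g\<close> recovers the level\<close>
    let ?g = "inv_into {..<length p} (\<lambda>n. Inr (w n) :: stick + stick)"
    let ?J = "(\<lambda>n. Inr (w n)) ` {..<length p} :: (stick + stick) set"
    have "prob (\<Inter>u\<in>?J. f (?g u)) = (\<Prod>u\<in>?J. prob (f (?g u)))"
    proof (rule indep_setsD[OF indep])
      show "?J \<subseteq> sticks k R <+> sticks k R" using w by auto
      show "\<forall>u\<in>?J. f (?g u) \<in> case_sum cut_algebra status_algebra u"
        using f by (auto simp: inv_into_f_f[OF inj])
    qed (use False in auto)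
    moreover have "(\<Inter>u\<in>?J. f (?g u)) = (\<Inter>n<length p. f n)"
      by (simp add: inv_into_f_f[OF inj])
    moreover have "(\<Prod>u\<in>?J. prob (f (?g u))) = (\<Prod>n<length p. prob (f n))"
      by (subst prod.reindex[OF inj]) (simp add: inv_into_f_f[OF inj])
    moreover have "\<dots> = r ^ length p"
      unfolding f_def using prob_alive[OF w pn] by simp
    moreover have "space M \<inter> (\<Inter>n<length p. f n) = (\<Inter>n<length p. f n)"
      using False by (auto simp: f_def)
    ultimately show ?thesis unfolding eq by (simp add: v)
  qed
qed

abbreviation living_count :: "'a \<Rightarrow> real" where
  "living_count \<omega> \<equiv> real (card (living k R (\<lambda>v. A v \<omega>)))"

text \<open>Level \<open>m\<close> has \<open>R * k ^ m\<close> potential sticks, each alive with probability \<open>r ^ m\<close>; the condition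
  \<open>r < 1 / k\<close> is what makes the resulting series converge. Since \<open>card\<close> is 0 on infinite sets,
  the sum is first taken in the extended reals, where its finite expectation shows that almost
  surely only finitely many sticks ever live.\<close>

lemma living_count:
  shows "AE \<omega> in M. finite (living k R (\<lambda>v. A v \<omega>))"
    and "integrable M living_count"
    and "expectation living_count = R / (1 - k * r)"
proof -
  define lv where "lv m = {..<R} \<times> {p. set p \<subseteq> {..<k} \<and> length p = m}" for m
  define S where "S \<omega> = living k R (\<lambda>v. A v \<omega>)" for \<omega>
  define Y where "Y \<omega> = emeasure (count_space UNIV) (S \<omega>)" for \<omega>
  have fin: "finite (lv m)" for m by (simp add: lv_def finite_lists_length_eq)
  have lv_sticks: "lv m \<subseteq> sticks k R" for m by (auto simp: lv_def sticks_def in_lists_conv_set)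
  have sticks_lv: "sticks k R = (\<Union>m. lv m)" by (auto simp: lv_def sticks_def in_lists_conv_set)
  have card_lv: "card (lv m) = R * k ^ m" for m
    by (simp add: lv_def card_cartesian_product card_lists_length_eq)
  have Y: "Y \<omega> = (\<Sum>m. \<Sum>v\<in>lv m. indicator {\<omega>\<in>space M. v \<in> S \<omega>} \<omega>)" if "\<omega> \<in> space M" for \<omega>
  proof -
    have "S \<omega> = (\<Union>m. S \<omega> \<inter> lv m)"
      using living_subset_sticks[of k R "\<lambda>v. A v \<omega>"] unfolding S_def sticks_lv by auto
    moreover have "(\<Sum>m. emeasure (count_space UNIV) (S \<omega> \<inter> lv m))
        = emeasure (count_space UNIV) (\<Union>m. S \<omega> \<inter> lv m)"
      by (rule suminf_emeasure) (auto simp: disjoint_family_on_def lv_def)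
    moreover have "emeasure (count_space UNIV) (S \<omega> \<inter> lv m)
        = (\<Sum>v\<in>lv m. indicator {\<omega>\<in>space M. v \<in> S \<omega>} \<omega>)" for m
    proof -
      have "(\<Sum>v\<in>lv m. indicator {\<omega>\<in>space M. v \<in> S \<omega>} \<omega> :: ennreal)
          = (\<Sum>v\<in>lv m. if v \<in> S \<omega> then 1 else 0)"
        using that by (intro sum.cong) (auto simp: indicator_def)
      also have "\<dots> = of_nat (card (lv m \<inter> S \<omega>))"
        using fin by (simp add: sum.If_cases)
      finally show ?thesis using fin by (simp add: Int_commute)
    qed
    ultimately show ?thesis unfolding Y_def by simp
  qed
  have ev [measurable]: "{\<omega>\<in>space M. v \<in> S \<omega>} \<in> events" if "v \<in> lv m" for v m
    unfolding S_def using that lv_sticks by (blast intro: living_event(1))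
  have meas: "Y \<in> borel_measurable M"
    by (subst measurable_cong[OF Y]) (auto intro!: borel_measurable_suminf borel_measurable_sum)
  have "(\<integral>\<^sup>+\<omega>. Y \<omega> \<partial>M)
      = (\<integral>\<^sup>+\<omega>. (\<Sum>m. \<Sum>v\<in>lv m. indicator {\<omega>\<in>space M. v \<in> S \<omega>} \<omega>) \<partial>M)"
    by (rule nn_integral_cong) (rule Y)
  also have "\<dots> = (\<Sum>m. \<Sum>v\<in>lv m. emeasure M {\<omega>\<in>space M. v \<in> S \<omega>})"
    by (subst nn_integral_suminf) (auto simp: nn_integral_sum)
  also have "\<dots> = (\<Sum>m. ennreal (R * (k * r) ^ m))"
  proof (intro suminf_cong)
    fix m
    have "(\<Sum>v\<in>lv m. emeasure M {\<omega>\<in>space M. v \<in> S \<omega>}) = (\<Sum>v\<in>lv m. ennreal (r ^ m))"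
    proof (rule sum.cong)
      fix v assume v: "v \<in> lv m"
      then have "v \<in> sticks k R" "length (snd v) = m" using lv_sticks by (auto simp: lv_def)
      then show "emeasure M {\<omega>\<in>space M. v \<in> S \<omega>} = ennreal (r ^ m)"
        unfolding S_def by (simp add: emeasure_eq_measure living_event(2))
    qed simp
    also have "\<dots> = ennreal (R * (k * r) ^ m)"
      using r0 by (simp add: card_lv power_mult_distrib ennreal_mult ennreal_of_nat_eq_real_of_nat
          ennreal_power mult.assoc)
    finally show "(\<Sum>v\<in>lv m. emeasure M {\<omega>\<in>space M. v \<in> S \<omega>}) = ennreal (R * (k * r) ^ m)" .
  qed
  also have "\<dots> = ennreal (R / (1 - k * r))"
  proof (rule suminf_ennreal_eq)
    have "\<bar>k * r\<bar> < 1" using r0 r1 k by (simp add: field_simps)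
    then have "(\<lambda>m. R * (k * r) ^ m) sums (R * (1 / (1 - k * r)))"
      by (intro sums_mult geometric_sums) auto
    then show "(\<lambda>m. R * (k * r) ^ m) sums (R / (1 - k * r))" by simp
  qed (use r0 in auto)
  finally have int: "(\<integral>\<^sup>+\<omega>. Y \<omega> \<partial>M) = ennreal (R / (1 - k * r))" .
  have "AE \<omega> in M. Y \<omega> \<noteq> \<infinity>"
    using meas int by (intro nn_integral_noteq_infinite) auto
  then show fin_ae: "AE \<omega> in M. finite (living k R (\<lambda>v. A v \<omega>))"
    by eventually_elim (auto simp: Y_def S_def emeasure_count_space split: if_splits)
  have card_Y: "living_count \<omega> = enn2real (Y \<omega>)" for \<omega>
    unfolding Y_def S_def
    by (cases "finite (living k R (\<lambda>v. A v \<omega>))") (simp_all add: ennreal_of_nat_eq_real_of_nat)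
  have [measurable]: "living_count \<in> borel_measurable M"
    unfolding card_Y using meas by measurable
  have "(\<integral>\<^sup>+\<omega>. ennreal (living_count \<omega>) \<partial>M) = (\<integral>\<^sup>+\<omega>. Y \<omega> \<partial>M)"
    using fin_ae by (intro nn_integral_cong_AE, eventually_elim)
      (auto simp: Y_def S_def ennreal_of_nat_eq_real_of_nat)
  then have hi: "has_bochner_integral M living_count (R / (1 - k * r))"
    using r0 r1 k unfolding int
    by (intro has_bochner_integral_nn_integral) (auto simp: field_simps)
  then show "integrable M living_count" "expectation living_count = R / (1 - k * r)"
    by (auto simp: has_bochner_integral_iff)
qed

abbreviation large_dead_count :: "'a \<Rightarrow> real" where
  "large_dead_count \<omega> \<equiv>
     real (card {w \<in> {..<R} \<times> {..<k}. dead_large_child k (\<lambda>v. X v \<omega>) (\<lambda>v. A v \<omega>) w})"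

lemma dead_large_child_event:
  assumes j: "j < R" and i: "i < k"
  defines "T \<equiv> {\<omega> \<in> space M. dead_large_child k (\<lambda>v. X v \<omega>) (\<lambda>v. A v \<omega>) (j, i)}"
  shows "T \<in> events"
    and "prob T = (1 - r) * measure D {x \<in> space D. gap (k - 1) x i \<in> {1 / real k..1}}"
proof -
  define v :: stick where "v = (j, [])"
  define U where "U = {x \<in> space D. gap (k - 1) x i \<in> {1 / real k..1}}"
  have v: "v \<in> sticks k R" using j by (simp add: v_def sticks_def)
  have X: "X v \<in> measurable M (cut_space (k - 1))" and distr: "distr M (cut_space (k - 1)) (X v) = D"
    using process v by (auto simp: fragmentation_process_def)
  have U: "U \<in> sets D"
    using sum_prob_large_gap(2)[OF good, of i] i k by (simp add: U_def)
  then have U': "U \<in> sets (cut_space (k - 1))" by (subst (asm) distr[symmetric]) simp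
  have spaceD: "space D = space (cut_space (k - 1))" by (subst distr[symmetric]) simp
  define C where "C = X v -` U \<inter> space M"
  define S where "S = {\<omega> \<in> space M. i \<notin> A v \<omega>}"
  have C: "C \<in> cut_algebra v" unfolding C_def using U' by (rule in_vimage_algebra)
  have S: "S \<in> status_algebra v" unfolding S_def by (rule status_event[OF v])
  have "T = C \<inter> S"
    using measurable_space[OF X] unfolding T_def C_def S_def U_def dead_large_child_def spaceD
    by (auto simp: v_def)
  moreover have CS: "C \<in> events" "S \<in> events" using C S algebra_events[OF v] by auto
  ultimately show "T \<in> events" by simp
  have "prob (\<Inter>u\<in>{Inl v, Inr v}. case_sum (\<lambda>_. C) (\<lambda>_. S) u)
      = (\<Prod>u\<in>{Inl v, Inr v}. prob (case_sum (\<lambda>_. C) (\<lambda>_. S) u))"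
    using C S v by (intro indep_setsD[OF indep]) auto
  then have "prob T = prob C * prob S" unfolding \<open>T = C \<inter> S\<close> by simp
  moreover have "prob C = measure D U"
    unfolding C_def using measure_distr[OF X U'] unfolding distr by (rule sym)
  moreover have "prob S = 1 - r"
  proof -
    have "S = space M - {\<omega> \<in> space M. i \<in> A v \<omega>}" by (auto simp: S_def)
    moreover have "{\<omega> \<in> space M. i \<in> A v \<omega>} \<in> events"
      using status_event[OF v] algebra_events(2)[OF v] by blast
    ultimately show ?thesis using prob_alive[OF v i] by (simp add: prob_compl)
  qed
  ultimately show "prob T = (1 - r) * measure D {x \<in> space D. gap (k - 1) x i \<in> {1 / real k..1}}"
    by (simp add: U_def)
qed

lemma large_dead_count:
  shows "large_dead_count \<in> borel_measurable M"
    and "large_dead_count \<omega> \<le> k * R"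
    and "R * (1 - r) \<le> expectation large_dead_count"
proof -
  define T where "T w = {\<omega> \<in> space M. dead_large_child k (\<lambda>v. X v \<omega>) (\<lambda>v. A v \<omega>) w}" for w
  define I where "I = {..<R} \<times> {..<k}"
  have finI: "finite I" by (simp add: I_def)
  have T [measurable]: "T w \<in> events" if "w \<in> I" for w
    using that dead_large_child_event(1) by (auto simp: T_def I_def)
  have eq: "large_dead_count \<omega> = (\<Sum>w\<in>I. indicator (T w) \<omega>)" if "\<omega> \<in> space M" for \<omega>
  proof -
    have "(\<Sum>w\<in>I. indicator (T w) \<omega> :: real)
        = (\<Sum>w\<in>I. if dead_large_child k (\<lambda>v. X v \<omega>) (\<lambda>v. A v \<omega>) w then 1 else 0)"
      using that by (intro sum.cong) (auto simp: T_def)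
    also have "\<dots> = large_dead_count \<omega>"
      using finI by (simp add: sum.If_cases I_def[symmetric] Collect_conj_eq)
    finally show ?thesis by simp
  qed
  show "large_dead_count \<in> borel_measurable M"
    by (subst measurable_cong[OF eq]) (auto intro!: borel_measurable_sum)
  have "card {w \<in> I. dead_large_child k (\<lambda>v. X v \<omega>) (\<lambda>v. A v \<omega>) w} \<le> card I"
    using finI by (intro card_mono) auto
  then show "large_dead_count \<omega> \<le> k * R"
    unfolding I_def by (simp add: card_cartesian_product mult.commute flip: of_nat_mult)
  have "expectation large_dead_count = expectation (\<lambda>\<omega>. \<Sum>w\<in>I. indicator (T w) \<omega>)"
    by (rule Bochner_Integration.integral_cong) (auto simp: eq)
  also have "\<dots> = (\<Sum>w\<in>I. prob (T w))"
    using T by (subst Bochner_Integration.integral_sum) (auto simp: emeasure_eq_measure)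
  also have "\<dots> = (\<Sum>j<R. \<Sum>i<k. (1 - r) * measure D {x \<in> space D. gap (k - 1) x i \<in> {1 / real k..1}})"
    unfolding I_def sum.cartesian_product T_def using dead_large_child_event(2) by (intro sum.cong) auto
  also have "\<dots> = R * (1 - r) * (\<Sum>i<k. measure D {x \<in> space D. gap (k - 1) x i \<in> {1 / real k..1}})"
    by (simp add: sum_distrib_left mult.assoc)
  also have "\<dots> \<ge> R * (1 - r) * 1"
  proof (rule mult_left_mono)
    show "1 \<le> (\<Sum>i<k. measure D {x \<in> space D. gap (k - 1) x i \<in> {1 / real k..1}})"
      using sum_prob_large_gap(1)[OF good] k by simp
    have "1 / real k \<le> 1" using k by simp
    then show "0 \<le> real R * (1 - r)" using r1 by simp
  qed
  finally show "R * (1 - r) \<le> expectation large_dead_count" by simp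
qed

text \<open>The expectation of \<open>G * Z\<close>, where \<open>Z\<close> counts the living sticks, is bounded by means of the sure
  bound \<open>G \<le> k * R\<close>; the dependence between \<open>G\<close> and \<open>Z\<close> does not have to be understood.\<close>

lemma expectation_proportion_between:
  assumes L: "L > 0" and B: "L < B" "1 < B" "1 \<le> B * (L / k)"
    and s: "L \<le> s" "s' < B * (L / k)" and R: "R > 0"
  defines "P \<equiv> \<lambda>\<omega>. proportion_le B (ending k R (\<lambda>v. A v \<omega>)) (stick_length k L (\<lambda>v. X v \<omega>))"
  assumes int: "integrable M (\<lambda>\<omega>. P \<omega> s)" "integrable M (\<lambda>\<omega>. P \<omega> s')"
  shows "expectation (\<lambda>\<omega>. P \<omega> s') - expectation (\<lambda>\<omega>. P \<omega> s) \<le> 1 - (1 - r)\<^sup>2 * (1 - k * r) / k\<^sup>2"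
proof -
  have kr: "0 < 1 - k * r" using r1 k by (simp add: field_simps)
  have "1 / real k \<le> 1" using k by simp
  then have r: "0 < 1 - r" using r1 by linarith
  \<comment> \<open>the value of \<open>t\<close> at which \<open>2 * (1 - r) / t - k\<^sup>2 / (1 - k * r) / t\<^sup>2\<close> is largest\<close>
  define t where "t = k\<^sup>2 / ((1 - r) * (1 - k * r))"
  define C where "C = t * R"
  have t: "t > 0" using k kr r by (simp add: t_def)
  then have C: "C > 0" using R by (simp add: C_def)
  let ?G = large_dead_count and ?Z = living_count
  have [measurable]: "?G \<in> borel_measurable M" "?Z \<in> borel_measurable M"
    using large_dead_count(1) living_count(2) by auto
  have intG: "integrable M ?G"
    using large_dead_count(2) by (intro integrable_const_bound[where B = "k * R"]) auto
  have intGZ: "integrable M (\<lambda>\<omega>. ?G \<omega> * ?Z \<omega>)"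
  proof (rule Bochner_Integration.integrable_bound)
    show "integrable M (\<lambda>\<omega>. (k * R) * ?Z \<omega>)" using living_count(2) by simp
    show "AE \<omega> in M. norm (?G \<omega> * ?Z \<omega>) \<le> norm ((k * R) * ?Z \<omega>)"
      using large_dead_count(2) by (intro AE_I2) (simp add: abs_mult mult_right_mono)
  qed measurable
  have "expectation (\<lambda>\<omega>. ?G \<omega> * ?Z \<omega>) \<le> expectation (\<lambda>\<omega>. (k * R) * ?Z \<omega>)"
    using intGZ living_count(2) large_dead_count(2)
    by (intro integral_mono mult_right_mono) auto
  then have EGZ: "expectation (\<lambda>\<omega>. ?G \<omega> * ?Z \<omega>) \<le> k * R * (R / (1 - k * r))"
    using living_count(3) by simp
  have "expectation (\<lambda>\<omega>. P \<omega> s') - expectation (\<lambda>\<omega>. P \<omega> s) = expectation (\<lambda>\<omega>. P \<omega> s' - P \<omega> s)"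
    using int by simp
  also have "\<dots> \<le> expectation (\<lambda>\<omega>. 1 - (2 / C * ?G \<omega> - k / C\<^sup>2 * (?G \<omega> * ?Z \<omega>)))"
  proof (rule integral_mono_AE)
    show "AE \<omega> in M. P \<omega> s' - P \<omega> s \<le> 1 - (2 / C * ?G \<omega> - k / C\<^sup>2 * (?G \<omega> * ?Z \<omega>))"
      using living_count(1)
    proof eventually_elim
      case (elim \<omega>)
      show ?case
        using proportion_between[OF L k B C s elim, of "\<lambda>v. X v \<omega>"]
        unfolding P_def by (simp add: algebra_simps)
    qed
  qed (use int intG intGZ in auto)
  also have "\<dots> = 1 - (2 / C * expectation ?G - k / C\<^sup>2 * expectation (\<lambda>\<omega>. ?G \<omega> * ?Z \<omega>))"
    using intG intGZ by (simp add: prob_space)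
  also have "\<dots> \<le> 1 - (2 / C * (R * (1 - r)) - k / C\<^sup>2 * (k * R * (R / (1 - k * r))))"
    using large_dead_count(3) EGZ C k
    by (intro diff_left_mono diff_mono mult_left_mono) auto
  also have "2 / C * (R * (1 - r)) - k / C\<^sup>2 * (k * R * (R / (1 - k * r))) = 2 * (1 - r) / t - k\<^sup>2 / (1 - k * r) / t\<^sup>2"
    using R t kr by (simp add: C_def field_simps power2_eq_square)
  also have "k\<^sup>2 / (1 - k * r) = (1 - r) * t"
    using kr r by (simp add: t_def)
  also have "2 * (1 - r) / t - (1 - r) * t / t\<^sup>2 = (1 - r) / t"
    using t by (simp add: field_simps power2_eq_square)
  also have "(1 - r) / t = (1 - r)\<^sup>2 * (1 - k * r) / k\<^sup>2"
    using kr r by (simp add: t_def power2_eq_square)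
  finally show ?thesis .
qed

end

section \<open>Failure of Benford behavior\<close>

theorem theorem1p11:
  fixes k :: nat and L r :: real and D :: "(nat \<Rightarrow> real) measure"
    and M :: "nat \<Rightarrow> 'a measure"
    and X :: "nat \<Rightarrow> stick \<Rightarrow> 'a \<Rightarrow> nat \<Rightarrow> real"
    and A :: "nat \<Rightarrow> stick \<Rightarrow> 'a \<Rightarrow> nat set"
  assumes "k \<ge> 2" and "L > 0"
    and "good_distribution (k - 1) D"
    and "0 \<le> r" and "r < 1 / real k"
    and "\<And>R. R \<ge> 1 \<Longrightarrow> fragmentation_process k D r R (M R) (X R) (A R)"
  shows "\<forall>\<^sub>F B in at_top. \<not> strong_benford B M
           (\<lambda>R \<omega>. ending k R (\<lambda>v. A R v \<omega>))
           (\<lambda>R \<omega>. stick_length k L (\<lambda>v. X R v \<omega>))"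
proof -
  define c where "c = (1 - r)\<^sup>2 * (1 - k * r) / k\<^sup>2"
  have "1 / real k \<le> 1" using assms(1) by simp
  then have "0 < 1 - r" using assms(5) by linarith
  then have c: "c > 0" using assms(1,4,5) by (simp add: c_def field_simps)
  define s where "s = L + 1"
  define \<delta> where "\<delta> = min (1 / 2) (L / (2 * k))"
  have \<delta>: "0 < \<delta>" "\<delta> < 1" "\<delta> < L / k"
    using assms(1,2) by (auto simp: \<delta>_def min_def field_simps)
  \<comment> \<open>this makes \<open>log B (B * \<delta>) - log B s\<close> exceed \<open>1 - c\<close>\<close>
  have "\<forall>\<^sub>F B in at_top. ln B > (ln s - ln \<delta>) / c"
    using ln_at_top filterlim_at_top_dense by blast
  moreover have "\<forall>\<^sub>F B in at_top. B > max s (1 / \<delta>)" by (rule eventually_gt_at_top)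
  ultimately show ?thesis
  proof eventually_elim
    case (elim B)
    have s: "s > 1" using assms(2) by (simp add: s_def)
    have B: "B > s" "B * \<delta> > 1" "B > 1" using elim(2) \<delta> s by (auto simp: field_simps)
    have BL: "1 \<le> B * (L / k)"
      using mult_strict_left_mono[OF \<delta>(3), of B] B by linarith
    have B\<delta>: "B * \<delta> < B * (L / k)" "B * \<delta> < B"
      using mult_strict_left_mono[OF \<delta>(3), of B] mult_strict_left_mono[OF \<delta>(2), of B] B by auto
    define P where "P R \<omega> = proportion_le B (ending k R (\<lambda>v. A R v \<omega>)) (stick_length k L (\<lambda>v. X R v \<omega>))"
      for R \<omega>
    show ?case
    proof
      assume "strong_benford B M (\<lambda>R \<omega>. ending k R (\<lambda>v. A R v \<omega>))
           (\<lambda>R \<omega>. stick_length k L (\<lambda>v. X R v \<omega>))"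
      then have lim: "(\<lambda>R. prob_space.expectation (M R) (\<lambda>\<omega>. P R \<omega> u)) \<longlonglongrightarrow> log B u"
        if "1 < u" "u < B" for u
        using that unfolding strong_benford_def P_def by simp
      \<comment> \<open>the expectation of a function that is not integrable is 0 by convention, so convergence to a
        positive limit forces integrability\<close>
      have int: "\<forall>\<^sub>F R in sequentially. integrable (M R) (\<lambda>\<omega>. P R \<omega> u)" if u: "1 < u" "u < B" for u
      proof -
        have "log B u > 0" using u by simp
        with lim[OF u] have "\<forall>\<^sub>F R in sequentially. 0 < prob_space.expectation (M R) (\<lambda>\<omega>. P R \<omega> u)"
          by (rule order_tendstoD)
        then show ?thesis
          by eventually_elim (metis not_integrable_integral_eq less_irrefl)
      qed
      have "\<forall>\<^sub>F R in sequentially. prob_space.expectation (M R) (\<lambda>\<omega>. P R \<omega> (B * \<delta>))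
          - prob_space.expectation (M R) (\<lambda>\<omega>. P R \<omega> s) \<le> 1 - c"
        using int[OF s B(1)] int[OF B(2) B\<delta>(2)] eventually_ge_at_top[of 1]
      proof eventually_elim
        case (elim R)
        have pr: "fragmentation_process k D r R (M R) (X R) (A R)" using assms(6) elim(3) .
        interpret prob_space "M R" using pr by (simp add: fragmentation_process_def)
        interpret fragmentation "M R" k D r R "X R" "A R"
          using pr assms by unfold_locales auto
        show ?case
          unfolding P_def c_def
          by (rule expectation_proportion_between[OF _ _ _ BL])
            (use elim assms B B\<delta> s in \<open>auto simp: s_def P_def\<close>)
      qed
      then have "log B (B * \<delta>) - log B s \<le> 1 - c"
        by (intro tendsto_upperbound[OF tendsto_diff[OF lim lim]]) (use s B B\<delta> in auto)
      moreover have "log B (B * \<delta>) - log B s = 1 + (ln \<delta> - ln s) / ln B"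
        using B(3) \<delta>(1) by (simp add: log_def ln_mult add_divide_distrib diff_divide_distrib)
      ultimately have "c \<le> (ln s - ln \<delta>) / ln B" by (simp add: diff_divide_distrib)
      then have "c * ln B \<le> ln s - ln \<delta>" using B(3) by (simp add: pos_le_divide_eq)
      with elim(1) c show False by (simp add: pos_divide_less_eq mult.commute)
    qed
  qed
qed

end
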